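(* For every integer $n>1$, \[ CP_{(2,0)}(n,X,Y)=\frac{1-X_{n-1}X_{n}Y_{n-2}Y_{n-1}}{(1-X_{n}Y_{n-2})(1-X_{n}Y_{n-1})(1-X_{n}Y_{n})}\, CP_{(2,0)}(n-1,X,Y). \]
   Context: Let $x_1,x_2,\dots,y_1,y_2,\dots$ be formal variables, $X_i:=x_1\cdots x_i$, $Y_i:=y_1\cdots y_i$ for $i\ge1$, and $X_i=Y_i:=1$ for $i\le 0$. For $n\ge1$, $CP_{(2,0)}(n,X,Y):=\sum \prod_{i=1}^n x_i^{a_i}y_i^{b_i}$, summed over all tuples of nonnegative integers $(a_1,\dots,a_n,b_1,\dots,b_n)$ with $a_1\ge\dots\ge a_n$, $b_1\ge\dots\ge b_n$, $a_j\ge b_{j}$ and $b_j\ge a_{j+2}$ for all $j\ge1$, where $a_j=b_j=0$ for $j>n$ (cylindric partitions with profile $(2,0)$ with at most $n$ nonzero entries in each row). *)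

theory Defs
  imports Main "HOL-Library.Poly_Mapping"
begin

text \<open>
  Formal power series in a (possibly infinite) family of commuting variables \<open>'v\<close> over a
  commutative ring: arbitrary coefficient functions on the monomials, where a monomial is a finitely
  supported exponent map \<open>'v \<Rightarrow>\<^sub>0 nat\<close>.
\<close>

typedef (overloaded) ('v, 'a) mfps = "UNIV :: (('v \<Rightarrow>\<^sub>0 nat) \<Rightarrow> 'a) set"
  morphisms mcoeff Abs_mfps
  by simp

setup_lifting type_definition_mfps

lemma mfps_eqI: "(\<And>m. mcoeff f m = mcoeff g m) \<Longrightarrow> f = g"
  by transfer auto

lemma finite_monomial_le:
  fixes m :: "'v \<Rightarrow>\<^sub>0 nat"
  shows "finite {p. \<exists>q. p + q = m}"
proof -
  let ?S = "{p. \<exists>q. p + q = m}"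
  let ?F = "{f. \<forall>v. (v \<in> Poly_Mapping.keys m \<longrightarrow> f v \<in> {..Max (range (Poly_Mapping.lookup m))})
                 \<and> (v \<notin> Poly_Mapping.keys m \<longrightarrow> f v = (0::nat))}"
  have fr: "finite (range (Poly_Mapping.lookup m))"
  proof (rule finite_subset)
    show "range (Poly_Mapping.lookup m)
            \<subseteq> insert 0 (Poly_Mapping.lookup m ` Poly_Mapping.keys m)"
      by (auto simp: in_keys_iff)
  qed simp
  have "finite ?F"
    by (rule finite_set_of_finite_funs) auto
  moreover have "Poly_Mapping.lookup ` ?S \<subseteq> ?F"
  proof clarsimp
    fix p q v
    assume "m = p + q"
    have "Poly_Mapping.lookup p v \<le> Poly_Mapping.lookup (p + q) v"
      by (simp add: lookup_add)
    also have "\<dots> \<le> Max (range (Poly_Mapping.lookup (p + q)))"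
      using fr \<open>m = p + q\<close> by (intro Max_ge) auto
    finally show "(v \<in> Poly_Mapping.keys (p + q) \<longrightarrow>
              Poly_Mapping.lookup p v \<le> Max (range (Poly_Mapping.lookup (p + q)))) \<and>
          (v \<notin> Poly_Mapping.keys (p + q) \<longrightarrow> Poly_Mapping.lookup p v = 0)"
      by (auto simp: in_keys_iff lookup_add)
  qed
  ultimately have "finite (Poly_Mapping.lookup ` ?S)"
    by (rule finite_subset[rotated])
  then show ?thesis
    by (rule finite_imageD) (auto intro: inj_onI poly_mapping_eqI)
qed

lemma finite_monomial_splits:
  fixes m :: "'v \<Rightarrow>\<^sub>0 nat"
  shows "finite {(p, q). p + q = m}"
proof (rule finite_subset)
  show "{(p, q). p + q = m} \<subseteq> {p. \<exists>q. p + q = m} \<times> {p. \<exists>q. p + q = m}"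
    by (auto intro: add.commute)
  show "finite ({p. \<exists>q. p + q = m} \<times> {p. \<exists>q. p + q = m})"
    by (intro finite_cartesian_product finite_monomial_le)
qed

instantiation mfps :: (type, comm_ring_1) comm_ring_1
begin

lift_definition zero_mfps :: "('a, 'b) mfps" is "\<lambda>_. 0" .
lift_definition one_mfps :: "('a, 'b) mfps" is "\<lambda>m. if m = 0 then 1 else 0" .
lift_definition plus_mfps :: "('a, 'b) mfps \<Rightarrow> ('a, 'b) mfps \<Rightarrow> ('a, 'b) mfps"
  is "\<lambda>f g m. f m + g m" .
lift_definition minus_mfps :: "('a, 'b) mfps \<Rightarrow> ('a, 'b) mfps \<Rightarrow> ('a, 'b) mfps"
  is "\<lambda>f g m. f m - g m" .
lift_definition uminus_mfps :: "('a, 'b) mfps \<Rightarrow> ('a, 'b) mfps"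
  is "\<lambda>f m. - f m" .
lift_definition times_mfps :: "('a, 'b) mfps \<Rightarrow> ('a, 'b) mfps \<Rightarrow> ('a, 'b) mfps"
  is "\<lambda>f g m. \<Sum>(p, q) | p + q = m. f p * g q" .

instance
proof
  fix f g h :: "('a, 'b) mfps"
  show "f * g = g * f"
  proof (rule mfps_eqI)
    fix m
    show "mcoeff (f * g) m = mcoeff (g * f) m"
      unfolding times_mfps.rep_eq
      by (rule sum.reindex_bij_witness[where i = prod.swap and j = prod.swap])
         (auto simp: ac_simps)
  qed
  show "f * g * h = f * (g * h)"
  proof (rule mfps_eqI)
    fix m
    have "mcoeff (f * g * h) m =
        (\<Sum>z\<in>{(u, q). u + q = m}. \<Sum>w\<in>{(r, s). r + s = fst z}.
            mcoeff f (fst w) * mcoeff g (snd w) * mcoeff h (snd z))"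
      unfolding times_mfps.rep_eq
      by (auto simp: case_prod_unfold sum_distrib_right intro!: sum.cong)
    also have "\<dots> = (\<Sum>(z, w)\<in>Sigma {(u, q). u + q = m} (\<lambda>z. {(r, s). r + s = fst z}).
            mcoeff f (fst w) * mcoeff g (snd w) * mcoeff h (snd z))"
      by (subst sum.Sigma) (auto intro: finite_monomial_splits)
    also have "\<dots> = (\<Sum>(z, w)\<in>Sigma {(r, u). r + u = m} (\<lambda>z. {(s, q). s + q = snd z}).
            mcoeff f (fst z) * (mcoeff g (fst w) * mcoeff h (snd w)))"
      by (rule sum.reindex_bij_witness[where
            j = "\<lambda>(z, w). ((fst w, snd w + snd z), (snd w, snd z))" and
            i = "\<lambda>(z, w). ((fst z + fst w, snd w), (fst z, fst w))"])
         (auto simp: ac_simps)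
    also have "\<dots> = (\<Sum>z\<in>{(r, u). r + u = m}. \<Sum>w\<in>{(s, q). s + q = snd z}.
            mcoeff f (fst z) * (mcoeff g (fst w) * mcoeff h (snd w)))"
      by (subst sum.Sigma) (auto intro: finite_monomial_splits)
    also have "\<dots> = mcoeff (f * (g * h)) m"
      unfolding times_mfps.rep_eq
      by (auto simp: case_prod_unfold sum_distrib_left intro!: sum.cong)
    finally show "mcoeff (f * g * h) m = mcoeff (f * (g * h)) m" .
  qed
  show "1 * f = f"
  proof (rule mfps_eqI)
    fix m
    have "mcoeff (1 * f) m = (\<Sum>(p, q)\<in>{(0 :: 'a \<Rightarrow>\<^sub>0 nat, m)}. (if p = 0 then 1 else 0) * mcoeff f q)"
      unfolding times_mfps.rep_eq one_mfps.rep_eq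
      by (rule sum.mono_neutral_right) (auto simp: finite_monomial_splits split: if_splits)
    then show "mcoeff (1 * f) m = mcoeff f m" by simp
  qed
  show "(f + g) * h = f * h + g * h"
    by (rule mfps_eqI)
       (simp add: times_mfps.rep_eq plus_mfps.rep_eq case_prod_unfold distrib_right sum.distrib)
  show "(0 :: ('a, 'b) mfps) \<noteq> 1"
    by transfer (metis zero_neq_one)
qed (transfer; simp add: algebra_simps; fail)+

end

text \<open>
  The multiplicative inverse of a unit (elements which are not units get the junk value 0), and the
  induced division.
\<close>

instantiation mfps :: (type, comm_ring_1) inverse
begin

definition inverse_mfps :: "('a, 'b) mfps \<Rightarrow> ('a, 'b) mfps"
  where "inverse_mfps f = (if f dvd 1 then THE g. f * g = 1 else 0)"

definition divide_mfps :: "('a, 'b) mfps \<Rightarrow> ('a, 'b) mfps \<Rightarrow> ('a, 'b) mfps"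
  where "divide_mfps f g = f * inverse g"

instance ..

end

lemma mfps_inverse_unique:
  fixes f g :: "('v, 'a::comm_ring_1) mfps"
  assumes "f * g = 1"
  shows "inverse f = g"
proof -
  have "(THE g. f * g = 1) = g"
  proof (rule the_equality)
    fix h assume "f * h = 1"
    then show "h = g" using assms by (metis mult.commute mult.left_commute mult_1_right)
  qed (fact assms)
  with assms show ?thesis by (auto simp: inverse_mfps_def dvd_def)
qed

lift_definition mvar :: "'v \<Rightarrow> ('v, 'a::comm_ring_1) mfps"
  is "\<lambda>v m. if m = Poly_Mapping.single v 1 then 1 else 0" .

text \<open>
  Coefficientwise sum of a family of power series, meaningful when every monomial has a nonzero
  coefficient in only finitely many members of the family.
\<close>

definition mfps_summable :: "('i \<Rightarrow> ('v, 'a::comm_ring_1) mfps) \<Rightarrow> 'i set \<Rightarrow> bool"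
  where "mfps_summable f I \<longleftrightarrow> (\<forall>m. finite {i \<in> I. mcoeff (f i) m \<noteq> 0})"

lift_definition mfps_Sum :: "('i \<Rightarrow> ('v, 'a::comm_ring_1) mfps) \<Rightarrow> 'i set \<Rightarrow> ('v, 'a) mfps"
  is "\<lambda>f I m. \<Sum>i | i \<in> I \<and> f i m \<noteq> 0. f i m" .

datatype var = VarX nat | VarY nat

definition xv :: "nat \<Rightarrow> (var, 'a::comm_ring_1) mfps" where "xv i = mvar (VarX i)"
definition yv :: "nat \<Rightarrow> (var, 'a::comm_ring_1) mfps" where "yv i = mvar (VarY i)"

definition XX :: "nat \<Rightarrow> (var, 'a::comm_ring_1) mfps" where "XX i = (\<Prod>k=1..i. xv k)"
definition YY :: "nat \<Rightarrow> (var, 'a::comm_ring_1) mfps" where "YY i = (\<Prod>k=1..i. yv k)"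

text \<open>
  A pair of rows \<open>(a\<^sub>1, \<dots>, a\<^sub>n)\<close>, \<open>(b\<^sub>1, \<dots>, b\<^sub>n)\<close> is encoded by functions extended by zero; the
  value at the unused index \<open>0\<close> is also fixed to be zero, so that the encoding is unique.
\<close>

definition cylindric20 :: "nat \<Rightarrow> ((nat \<Rightarrow> nat) \<times> (nat \<Rightarrow> nat)) set" where
  "cylindric20 n = {(a, b).
     (\<forall>j. j \<notin> {1..n} \<longrightarrow> a j = 0 \<and> b j = 0) \<and>
     (\<forall>j. 1 \<le> j \<and> j < n \<longrightarrow> a j \<ge> a (j + 1) \<and> b j \<ge> b (j + 1)) \<and>
     (\<forall>j\<ge>1. a j \<ge> b j \<and> b j \<ge> a (j + 2))}"

definition weight :: "nat \<Rightarrow> (nat \<Rightarrow> nat) \<times> (nat \<Rightarrow> nat) \<Rightarrow> (var, 'a::comm_ring_1) mfps" where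
  "weight n = (\<lambda>(a, b). \<Prod>i=1..n. xv i ^ a i * yv i ^ b i)"

definition CP20 :: "nat \<Rightarrow> (var, 'a::comm_ring_1) mfps" where
  "CP20 n = mfps_Sum (weight n) (cylindric20 n)"

definition mmonom :: "('v \<Rightarrow>\<^sub>0 nat) \<Rightarrow> ('v, 'a::comm_ring_1) mfps"
  where "mmonom k = Abs_mfps (\<lambda>m. if m = k then 1 else 0)"

lemma mcoeff_mmonom: "mcoeff (mmonom k) m = (if m = k then 1 else 0)"
  by (simp add: mmonom_def Abs_mfps_inverse)

lemma mmonom_0: "mmonom 0 = 1"
  by (rule mfps_eqI) (simp add: mcoeff_mmonom one_mfps.rep_eq)

lemma mvar_conv_mmonom: "mvar v = mmonom (Poly_Mapping.single v 1)"
  by (rule mfps_eqI) (simp add: mcoeff_mmonom mvar.rep_eq)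

lemma mmonom_mult: "mmonom k * mmonom l = (mmonom (k + l) :: ('v, 'a::comm_ring_1) mfps)"
proof (rule mfps_eqI)
  fix m
  have "mcoeff (mmonom k * mmonom l :: ('v, 'a) mfps) m =
      (\<Sum>z\<in>{(p, q). p + q = m}. if z = (k, l) then 1 else 0)"
    unfolding times_mfps.rep_eq mcoeff_mmonom by (intro sum.cong) (auto split: if_splits)
  also have "\<dots> = mcoeff (mmonom (k + l)) m"
    by (subst sum.delta) (auto simp: finite_monomial_splits mcoeff_mmonom)
  finally show "mcoeff (mmonom k * mmonom l :: ('v, 'a) mfps) m = mcoeff (mmonom (k + l)) m" .
qed

lemma mvar_power: "mvar v ^ e = mmonom (Poly_Mapping.single v e)"
  by (induction e)
     (auto simp: mmonom_0 mvar_conv_mmonom mmonom_mult simp flip: single_add)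

lemma mmonom_prod: "finite A \<Longrightarrow> (\<Prod>i\<in>A. mmonom (k i)) = mmonom (\<Sum>i\<in>A. k i)"
  by (induction A rule: finite_induct) (auto simp: mmonom_0 mmonom_mult)

lemma weight_conv_mmonom:
  "weight n (a, b) = mmonom (\<Sum>i=1..n. Poly_Mapping.single (VarX i) (a i)
                                     + Poly_Mapping.single (VarY i) (b i))"
  by (simp add: weight_def xv_def yv_def mvar_power mmonom_mult mmonom_prod)

lemma mfps_summable_CP20:
  "mfps_summable (weight n :: _ \<Rightarrow> (var, 'a::comm_ring_1) mfps) (cylindric20 n)"
  unfolding mfps_summable_def
proof
  fix m
  let ?E = "\<lambda>a b. \<Sum>i=1..n. Poly_Mapping.single (VarX i) (a i)
                          + Poly_Mapping.single (VarY i) (b i) :: var \<Rightarrow>\<^sub>0 nat"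
  let ?S = "{i \<in> cylindric20 n. mcoeff (weight n i :: (var, 'a) mfps) m \<noteq> 0}"
  let ?c = "\<lambda>V j. if j \<in> {1..n} then Poly_Mapping.lookup m (V j) else 0"
  have "?S \<subseteq> {(?c VarX, ?c VarY)}"
  proof
    fix z assume "z \<in> ?S"
    then obtain a b where z: "z = (a, b)" and c: "(a, b) \<in> cylindric20 n"
      and w: "mcoeff (weight n (a, b) :: (var, 'a) mfps) m \<noteq> 0"
      by (cases z) auto
    from w have m: "m = ?E a b"
      by (auto simp: weight_conv_mmonom mcoeff_mmonom split: if_splits)
    have "a j = ?c VarX j \<and> b j = ?c VarY j" for j
    proof (cases "j \<in> {1..n}")
      case True
      then show ?thesis
        by (simp add: m lookup_sum lookup_add lookup_single when_def)
    next
      case False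
      with c show ?thesis
        unfolding cylindric20_def by auto
    qed
    then show "z \<in> {(?c VarX, ?c VarY)}" unfolding z by auto
  qed
  then show "finite ?S" by (rule finite_subset) simp
qed

end

theory Submission
  imports Defs
begin

text \<open>
  The inequalities say that the entries decrease along the poset
  \<open>a\<^sub>1 > {a\<^sub>2, b\<^sub>1} > {a\<^sub>3, b\<^sub>2} > \<dots> > {a\<^sub>n, b\<^sub>n\<^sub>-\<^sub>1} > b\<^sub>n\<close>, whose braces are two-element antichains.
  Adding 1 to \<open>a\<^sub>1, \<dots>, a\<^sub>n, b\<^sub>1, \<dots>, b\<^sub>q\<close> multiplies the weight by \<open>X\<^sub>n Y\<^sub>q\<close>. Hence, for \<open>n - 2 \<le> q \<le> n\<close>, multiplying the
  generating function of the partitions with \<open>b\<^sub>j = 0\<close> for \<open>j > q\<close> by \<open>1 - X\<^sub>n Y\<^sub>q\<close> keeps just those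
  with \<open>a\<^sub>n = 0\<close> or \<open>b\<^sub>q = 0\<close>. Applying this for \<open>q = n\<close> and \<open>q = n - 1\<close> leaves the
  partitions with \<open>b\<^sub>n = 0\<close> and \<open>a\<^sub>n = 0 \<or> b\<^sub>n\<^sub>-\<^sub>1 = 0\<close>, which are counted by inclusion-exclusion:
  those with \<open>a\<^sub>n = 0\<close> give \<open>P = CP(n - 1)\<close>, those with both entries zero give
  \<open>(1 - X\<^sub>n\<^sub>-\<^sub>1 Y\<^sub>n\<^sub>-\<^sub>1) P\<close> by the same step for \<open>n - 1\<close>, and those with \<open>b\<^sub>n\<^sub>-\<^sub>1 = 0\<close> are obtained
  from the latter on dividing by \<open>1 - X\<^sub>n Y\<^sub>n\<^sub>-\<^sub>2\<close>, by the case \<open>q = n - 2\<close>.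
\<close>

section \<open>Sums of families of power series\<close>

text \<open>\<open>mfps_Sum\<close> adds over the exact support at \<open>m\<close>, which varies
  with \<open>m\<close>; a finite superset \<open>F\<close> gives one index set for several
  coefficients at once.\<close>

lemma mcoeff_mfps_Sum_superset:
  assumes "finite F" "{i \<in> A. mcoeff (f i) m \<noteq> 0} \<subseteq> F" "F \<subseteq> A"
  shows "mcoeff (mfps_Sum f A) m = (\<Sum>i\<in>F. mcoeff (f i) m)"
  unfolding mfps_Sum.rep_eq
  by (rule sum.mono_neutral_left) (use assms in auto)

lemma mfps_summable_subset:
  "mfps_summable f A \<Longrightarrow> B \<subseteq> A \<Longrightarrow> mfps_summable f B"
  unfolding mfps_summable_def by (blast intro: rev_finite_subset)

lemma mfps_Sum_cong:
  "A = B \<Longrightarrow> (\<And>i. i \<in> B \<Longrightarrow> f i = g i) \<Longrightarrow> mfps_Sum f A = mfps_Sum g B"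
  by (rule mfps_eqI) (auto simp: mfps_Sum.rep_eq intro!: sum.cong)

lemma mfps_Sum_Un_Int:
  assumes "mfps_summable f A" "mfps_summable f B"
  shows "mfps_Sum f (A \<union> B) + mfps_Sum f (A \<inter> B) = mfps_Sum f A + mfps_Sum f B"
proof (rule mfps_eqI)
  fix m
  let ?S = "\<lambda>I. {i \<in> I. mcoeff (f i) m \<noteq> 0}"
  have "finite (?S A)" "finite (?S B)"
    using assms by (auto simp: mfps_summable_def)
  moreover have "?S (A \<union> B) = ?S A \<union> ?S B" "?S (A \<inter> B) = ?S A \<inter> ?S B"
    by auto
  ultimately show "mcoeff (mfps_Sum f (A \<union> B) + mfps_Sum f (A \<inter> B)) m
      = mcoeff (mfps_Sum f A + mfps_Sum f B) m"
    unfolding plus_mfps.rep_eq mfps_Sum.rep_eq by (simp add: sum.union_inter)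
qed

lemma mfps_Sum_empty [simp]: "mfps_Sum f {} = 0"
  by (rule mfps_eqI) (simp add: mfps_Sum.rep_eq zero_mfps.rep_eq)

lemma mfps_Sum_singleton [simp]: "mfps_Sum f {i} = f i"
  proof (rule mfps_eqI)
  fix m
  show "mcoeff (mfps_Sum f {i}) m = mcoeff (f i) m"
    by (subst mcoeff_mfps_Sum_superset[where F = "{i}"]) auto
qed

lemma mfps_Sum_image:
  assumes "inj_on T A"
  shows "mfps_Sum f (T ` A) = mfps_Sum (\<lambda>i. f (T i)) A"
proof (rule mfps_eqI)
  fix m
  have "{i \<in> T ` A. mcoeff (f i) m \<noteq> 0} = T ` {i \<in> A. mcoeff (f (T i)) m \<noteq> 0}"
    by auto
  moreover have "inj_on T {i \<in> A. mcoeff (f (T i)) m \<noteq> 0}"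
    using assms by (auto simp: inj_on_def)
  ultimately show "mcoeff (mfps_Sum f (T ` A)) m = mcoeff (mfps_Sum (\<lambda>i. f (T i)) A) m"
    by (simp add: mfps_Sum.rep_eq sum.reindex)
qed

lemma mfps_Sum_mult_left:
  fixes f :: "'i \<Rightarrow> ('v, 'a::comm_ring_1) mfps"
  assumes "mfps_summable f A"
  shows "mfps_Sum (\<lambda>i. c * f i) A = c * mfps_Sum f A"
proof (rule mfps_eqI)
  fix m :: "'v \<Rightarrow>\<^sub>0 nat"
  let ?M = "{(p, q). p + q = m}"
  \<comment> \<open>\<open>m\<close> splits in finitely many ways and each factor \<open>q\<close>
    meets finitely many \<open>i\<close>, so one finite set \<open>F\<close> serves every
    \<open>q\<close> and the two summations can be exchanged.\<close>
  define F where "F = (\<Union>(p, q)\<in>?M. {i \<in> A. mcoeff (f i) q \<noteq> 0})"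
  have fin: "finite F"
    unfolding F_def using assms
    by (intro finite_UN_I finite_monomial_splits) (auto simp: mfps_summable_def)
  have sub: "F \<subseteq> A"
    by (auto simp: F_def)
  have supp: "mcoeff (f i) q = 0" if "(p, q) \<in> ?M" "i \<in> A - F" for p q i
    using that by (force simp: F_def)
  have "{i \<in> A. mcoeff (c * f i) m \<noteq> 0} \<subseteq> F"
  proof
    fix i assume i: "i \<in> {i \<in> A. mcoeff (c * f i) m \<noteq> 0}"
    show "i \<in> F"
    proof (rule ccontr)
      assume "i \<notin> F"
      then have "mcoeff (c * f i) m = 0"
        unfolding times_mfps.rep_eq using i by (intro sum.neutral) (use supp in fastforce)
      with i show False by simp
    qed
  qed
  then have "mcoeff (mfps_Sum (\<lambda>i. c * f i) A) m = (\<Sum>i\<in>F. mcoeff (c * f i) m)"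
    using fin sub by (intro mcoeff_mfps_Sum_superset)
  also have "\<dots> = (\<Sum>(p, q)\<in>?M. mcoeff c p * (\<Sum>i\<in>F. mcoeff (f i) q))"
    unfolding times_mfps.rep_eq
    by (subst sum.swap) (simp add: case_prod_unfold sum_distrib_left)
  also have "\<dots> = (\<Sum>(p, q)\<in>?M. mcoeff c p * mcoeff (mfps_Sum f A) q)"
  proof (rule sum.cong[OF refl], clarify)
    fix p q assume "m = p + q"
    then have "{i \<in> A. mcoeff (f i) q \<noteq> 0} \<subseteq> F"
      using supp by blast
    then show "mcoeff c p * (\<Sum>i\<in>F. mcoeff (f i) q) = mcoeff c p * mcoeff (mfps_Sum f A) q"
      using fin sub by (simp add: mcoeff_mfps_Sum_superset)
  qed
  also have "\<dots> = mcoeff (c * mfps_Sum f A) m"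
    by (simp add: times_mfps.rep_eq)
  finally show "mcoeff (mfps_Sum (\<lambda>i. c * f i) A) m = mcoeff (c * mfps_Sum f A) m" .
qed

text \<open>Applying \<open>T\<close> to the indices multiplies the sum by \<open>c\<close>, so
  subtracting \<open>c\<close> times the sum deletes the image of \<open>T\<close>. With
  \<open>T = Suc\<close> this sums a geometric series; with \<open>T = shift n q\<close> it peels a
  factor off the generating function.\<close>

lemma mfps_Sum_shift:
  fixes f :: "'i \<Rightarrow> ('v, 'a::comm_ring_1) mfps"
  assumes summ: "mfps_summable f A" and inj: "inj_on T A" and sub: "T ` A \<subseteq> A"
    and mult: "\<And>i. i \<in> A \<Longrightarrow> f (T i) = c * f i"
  shows "(1 - c) * mfps_Sum f A = mfps_Sum f (A - T ` A)"
proof -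
  have "mfps_Sum f (T ` A) = mfps_Sum (\<lambda>i. c * f i) A"
    using mult by (simp add: mfps_Sum_image[OF inj] cong: mfps_Sum_cong)
  then have image: "mfps_Sum f (T ` A) = c * mfps_Sum f A"
    by (simp add: mfps_Sum_mult_left[OF summ])
  have "mfps_Sum f ((A - T ` A) \<union> T ` A) + mfps_Sum f ((A - T ` A) \<inter> T ` A)
      = mfps_Sum f (A - T ` A) + mfps_Sum f (T ` A)"
    using sub by (intro mfps_Sum_Un_Int mfps_summable_subset[OF summ]) auto
  moreover have "(A - T ` A) \<union> T ` A = A" "(A - T ` A) \<inter> T ` A = {}"
    using sub by auto
  ultimately show ?thesis
    by (simp add: image algebra_simps)
qed

section \<open>Inverting one minus a monomial\<close>

lemma mmonom_power: "mmonom k ^ i = mmonom (\<Sum>j<i. k)"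
  using mmonom_prod[of "{..<i}" "\<lambda>_. k"] by simp

lemma dvd_one_minus_mmonom:
  fixes k :: "'v \<Rightarrow>\<^sub>0 nat"
  assumes "k \<noteq> 0"
  shows "(1 - mmonom k :: ('v, 'a::comm_ring_1) mfps) dvd 1"
proof -
  let ?f = "\<lambda>i. mmonom k ^ i :: ('v, 'a) mfps"
  obtain v where v: "Poly_Mapping.lookup k v \<noteq> 0"
    using assms by (metis lookup_zero poly_mapping_eqI)
  have "mfps_summable ?f UNIV"
    unfolding mfps_summable_def
  proof
    fix m
    \<comment> \<open>The exponent of \<open>v\<close> in \<open>mmonom k ^ i\<close> is
      \<open>i\<close> times its exponent in \<open>k\<close>, so \<open>m\<close> determines
      \<open>i\<close>.\<close>
    have "{i \<in> UNIV. mcoeff (?f i) m \<noteq> 0} \<subseteq> {Poly_Mapping.lookup m v div Poly_Mapping.lookup k v}"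
      using v by (auto simp: mmonom_power mcoeff_mmonom lookup_sum split: if_splits)
    then show "finite {i \<in> UNIV. mcoeff (?f i) m \<noteq> 0}"
      by (rule finite_subset) simp
  qed
  then have "(1 - mmonom k) * mfps_Sum ?f UNIV = mfps_Sum ?f (UNIV - range Suc)"
    by (rule mfps_Sum_shift) simp_all
  also have "UNIV - range Suc = {0}"
    using not0_implies_Suc by auto
  finally show ?thesis
    by (metis dvdI mfps_Sum_singleton power_0)
qed

lemma XX_mult_YY_conv_mmonom:
  "XX p * YY q = mmonom ((\<Sum>i=1..p. Poly_Mapping.single (VarX i) 1)
                       + (\<Sum>i=1..q. Poly_Mapping.single (VarY i) 1))"
  by (simp add: XX_def YY_def xv_def yv_def mvar_conv_mmonom mmonom_prod mmonom_mult)

lemma dvd_one_minus_XX_mult_YY: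
  assumes "p > 0"
  shows "(1 - XX p * YY q :: (var, 'a::comm_ring_1) mfps) dvd 1"
proof -
  let ?k = "(\<Sum>i=1..p. Poly_Mapping.single (VarX i) 1)
          + (\<Sum>i=1..q. Poly_Mapping.single (VarY i) 1) :: var \<Rightarrow>\<^sub>0 nat"
  have "Poly_Mapping.lookup ?k (VarX p) = 1"
    using assms by (simp add: lookup_add lookup_sum lookup_single when_def)
  then have "?k \<noteq> 0"
    by (metis lookup_zero zero_neq_one)
  then show ?thesis
    unfolding XX_mult_YY_conv_mmonom by (rule dvd_one_minus_mmonom)
qed

text \<open>\<open>inverse\<close> has the default value 0 on non-units, so a fraction is introduced
  only once its denominator is known to divide 1.\<close>

lemma mfps_eq_divide_multI:
  fixes d :: "('v, 'a::comm_ring_1) mfps"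
  assumes "d dvd 1" "d * s = c * t"
  shows "s = c / d * t"
proof -
  obtain e where e: "d * e = 1"
    using assms(1) by (metis dvdE)
  have "s = e * (d * s)"
    using e by (metis mult.assoc mult.commute mult_1)
  also have "\<dots> = c / d * t"
    by (simp add: assms(2) divide_mfps_def mfps_inverse_unique[OF e] mult_ac)
  finally show ?thesis .
qed

section \<open>Peeling off order filters\<close>

definition shift :: "nat \<Rightarrow> nat \<Rightarrow> (nat \<Rightarrow> nat) \<times> (nat \<Rightarrow> nat) \<Rightarrow> (nat \<Rightarrow> nat) \<times> (nat \<Rightarrow> nat)" where
  "shift p q = (\<lambda>(a, b). (\<lambda>j. a j + of_bool (j \<in> {1..p}), \<lambda>j. b j + of_bool (j \<in> {1..q})))"

lemma inj_shift: "inj (shift p q)"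
  by (auto simp: inj_def shift_def fun_eq_iff)

lemma prod_power_add_of_bool:
  fixes f :: "nat \<Rightarrow> 'a::comm_monoid_mult"
  assumes "p \<le> n"
  shows "(\<Prod>i=1..n. f i ^ (a i + of_bool (i \<in> {1..p}))) = (\<Prod>i=1..p. f i) * (\<Prod>i=1..n. f i ^ a i)"
proof -
  have "(\<Prod>i=1..n. f i ^ of_bool (i \<in> {1..p})) = (\<Prod>i=1..p. f i ^ of_bool (i \<in> {1..p}))"
    using assms by (intro prod.mono_neutral_right) auto
  then show ?thesis
    by (simp add: power_add prod.distrib mult.commute)
qed

lemma weight_shift:
  assumes "p \<le> n" "q \<le> n"
  shows "weight n (shift p q z) = XX p * YY q * weight n z"
  using assms
  by (cases z) (simp add: weight_def shift_def XX_def YY_def prod.distrib prod_power_add_of_bool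
      del: atLeastAtMost_iff One_nat_def)

definition cylindric20_le :: "nat \<Rightarrow> nat \<Rightarrow> ((nat \<Rightarrow> nat) \<times> (nat \<Rightarrow> nat)) set" where
  "cylindric20_le n q = {(a, b) \<in> cylindric20 n. \<forall>j>q. b j = 0}"

lemma cylindric20_antimono:
  assumes "(a, b) \<in> cylindric20 n" "1 \<le> i" "i \<le> j"
  shows "a j \<le> a i" "b j \<le> b i"
proof -
  \<comment> \<open>The definition compares neighbours only below \<open>n\<close>; from
    \<open>n\<close> on the next entry is 0.\<close>
  have *: "a (Suc k) \<le> a k \<and> b (Suc k) \<le> b k" if "k \<ge> 1" for k
    using assms(1) that by (cases "k < n") (auto simp: cylindric20_def)
  show "a j \<le> a i"
    using assms(3,2) by (induction j rule: dec_induct) (use * order_trans in auto)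
  show "b j \<le> b i"
    using assms(3,2) by (induction j rule: dec_induct) (use * order_trans in auto)
qed

text \<open>The bounds on \<open>q\<close> make the raised entries closed upwards: a raised
  \<open>b j\<close> has \<open>j \<le> q \<le> n\<close>, so \<open>a j\<close> is raised; a raised
  \<open>a (j + 2)\<close> has \<open>j \<le> n - 2 \<le> q\<close>, so \<open>b j\<close> is raised
  for \<open>j \<ge> 1\<close>.\<close>

lemma shift_in_cylindric20_le:
  assumes "q \<le> n" "n \<le> q + 2" "z \<in> cylindric20_le n q"
  shows "shift n q z \<in> cylindric20_le n q"
  using assms by (cases z) (auto simp: cylindric20_le_def cylindric20_def shift_def)

text \<open>Subtracting 1 gives the preimage. Rows decrease, so positivity of the last raised entry
  of each row is enough; for \<open>q = 0\<close> no \<open>b j\<close> is raised.\<close>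

lemma in_shift_image_iff:
  assumes "1 \<le> n" "q \<le> n" "n \<le> q + 2" and z: "(a, b) \<in> cylindric20_le n q"
  shows "(a, b) \<in> shift n q ` cylindric20_le n q \<longleftrightarrow> a n > 0 \<and> (q = 0 \<or> b q > 0)"
proof
  assume "(a, b) \<in> shift n q ` cylindric20_le n q"
  then show "a n > 0 \<and> (q = 0 \<or> b q > 0)"
    using assms by (auto simp: shift_def)
next
  assume pos: "a n > 0 \<and> (q = 0 \<or> b q > 0)"
  have b0: "b j = 0" if "j > q" for j
    using z that by (auto simp: cylindric20_le_def)
  let ?a = "\<lambda>j. a j - of_bool (j \<in> {1..n})"
  let ?b = "\<lambda>j. b j - of_bool (j \<in> {1..q})"
  have cyl: "(a, b) \<in> cylindric20 n"
    using z by (auto simp: cylindric20_le_def)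
  have a_pos: "a j > 0" if "j \<in> {1..n}" for j
    using cylindric20_antimono(1)[OF cyl, of j n] that pos by auto
  have b_pos: "b j > 0" if "j \<in> {1..q}" for j
    using cylindric20_antimono(2)[OF cyl, of j q] that pos by auto
  have "(a, b) = shift n q (?a, ?b)"
    using a_pos b_pos by (auto simp: shift_def fun_eq_iff of_bool_def Suc_leI)
  moreover have "(?a, ?b) \<in> cylindric20 n"
    unfolding cylindric20_def
  proof (clarify, intro conjI allI impI)
    fix j
    have D: "j \<ge> 1 \<Longrightarrow> a (j + 1) \<le> a j \<and> b (j + 1) \<le> b j \<and> b j \<le> a j \<and> a (j + 2) \<le> b j"
      using cyl cylindric20_antimono[OF cyl, of j "j + 1"] by (auto simp: cylindric20_def)
    have Z: "j \<notin> {1..n} \<Longrightarrow> a j = 0 \<and> b j = 0" for j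
      using cyl by (auto simp: cylindric20_def)
    show "?a j = 0" "?b j = 0" if "j \<notin> {1..n}"
      using Z[OF that] by auto
    \<comment> \<open>If the larger side of an inequality is lowered and the smaller is not, the
      smaller one lies beyond \<open>n\<close> (for \<open>a\<close>) or \<open>q\<close> (for
      \<open>b\<close>) and is 0.\<close>
    show "?a (j + 1) \<le> ?a j" if "1 \<le> j \<and> j < n"
      using D that by (auto simp: of_bool_def)
    show "?b (j + 1) \<le> ?b j" if "1 \<le> j \<and> j < n"
      using D that b0[of "j + 1"] by (auto simp: of_bool_def)
    show "?b j \<le> ?a j" if "1 \<le> j"
      using D that b0[of j] \<open>q \<le> n\<close> by (auto simp: of_bool_def)
    show "?a (j + 2) \<le> ?b j" if "1 \<le> j"
      using D that Z[of "j + 2"] \<open>n \<le> q + 2\<close> \<open>q \<le> n\<close> by (auto simp: of_bool_def)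
  qed
  then have "(?a, ?b) \<in> cylindric20_le n q"
    using b0 by (auto simp: cylindric20_le_def)
  ultimately show "(a, b) \<in> shift n q ` cylindric20_le n q"
    by (rule image_eqI)
qed

lemma mfps_summable_weight_cylindric20_le:
  "mfps_summable (weight n :: _ \<Rightarrow> (var, 'a::comm_ring_1) mfps) (cylindric20_le n q)"
  by (rule mfps_summable_subset[OF mfps_summable_CP20]) (auto simp: cylindric20_le_def)

text \<open>The guard \<open>q > 0\<close> matters for \<open>q = 0\<close>: there
  \<open>b 0 = 0\<close> holds by the encoding alone.\<close>

lemma peel_cylindric20_le:
  assumes "1 \<le> n" "q \<le> n" "n \<le> q + 2"
  shows "(1 - XX n * YY q) * mfps_Sum (weight n) (cylindric20_le n q) =
    (mfps_Sum (weight n) {(a, b) \<in> cylindric20_le n q. a n = 0 \<or> q > 0 \<and> b q = 0}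
      :: (var, 'a::comm_ring_1) mfps)"
proof -
  let ?C = "cylindric20_le n q"
  have "(1 - XX n * YY q) * mfps_Sum (weight n) ?C
      = (mfps_Sum (weight n) (?C - shift n q ` ?C) :: (var, 'a) mfps)"
    using assms shift_in_cylindric20_le
    by (intro mfps_Sum_shift mfps_summable_weight_cylindric20_le inj_on_subset[OF inj_shift])
       (auto simp: weight_shift)
  also have "?C - shift n q ` ?C = {(a, b) \<in> ?C. a n = 0 \<or> q > 0 \<and> b q = 0}"
  proof (rule set_eqI)
    fix z
    show "z \<in> ?C - shift n q ` ?C \<longleftrightarrow> z \<in> {(a, b) \<in> ?C. a n = 0 \<or> q > 0 \<and> b q = 0}"
      using in_shift_image_iff[OF assms, of "fst z" "snd z"] by (cases z) auto
  qed
  finally show ?thesis .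
qed

section \<open>Passing from \<open>n\<close> to \<open>n - 1\<close>\<close>

lemma cylindric20_le_self: "cylindric20_le n n = cylindric20 n"
  by (auto simp: cylindric20_le_def cylindric20_def)

text \<open>Thanks to the padding by zeros, both index sets can be compared directly, without an
  embedding.\<close>

lemma cylindric20_pred:
  assumes "n > 1"
  shows "cylindric20 (n - 1) = {(a, b) \<in> cylindric20 n. a n = 0 \<and> b n = 0}"
proof (intro equalityI subsetI)
  fix z assume "z \<in> cylindric20 (n - 1)"
  then obtain a b where z: "z = (a, b)" and c: "(a, b) \<in> cylindric20 (n - 1)"
    by (cases z) auto
  have "a (j + 1) \<le> a j \<and> b (j + 1) \<le> b j" if "1 \<le> j" for j
    using cylindric20_antimono[OF c, of j "j + 1"] that by auto
  then show "z \<in> {(a, b) \<in> cylindric20 n. a n = 0 \<and> b n = 0}"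
    using c assms by (auto simp: z cylindric20_def)
next
  fix z assume "z \<in> {(a, b) \<in> cylindric20 n. a n = 0 \<and> b n = 0}"
  then obtain a b where z: "z = (a, b)" and c: "(a, b) \<in> cylindric20 n" and "a n = 0" "b n = 0"
    by (cases z) auto
  then have "a j = 0 \<and> b j = 0" if "j \<notin> {1..n - 1}" for j
    using that by (cases "j = n") (auto simp: cylindric20_def)
  then show "z \<in> cylindric20 (n - 1)"
    using c by (auto simp: z cylindric20_def)
qed

lemma weight_pred:
  assumes "n > 1" "z \<in> cylindric20 (n - 1)"
  shows "weight (n - 1) z = weight n z"
proof -
  obtain m where n: "n = Suc m"
    using assms(1) by (cases n) auto
  show ?thesis
    using assms(2) by (cases z) (auto simp: n weight_def cylindric20_def)
qed

lemma CP20_pred: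
  "n > 1 \<Longrightarrow> CP20 (n - 1) = mfps_Sum (weight n) (cylindric20 (n - 1))"
  unfolding CP20_def by (intro mfps_Sum_cong weight_pred) auto

text \<open>Since \<open>b n \<le> a n\<close>, the alternative \<open>a n = 0\<close> forces
  \<open>b n = 0\<close>, so only the condition \<open>b n = 0\<close> survives.\<close>

lemma peel_CP20:
  assumes "1 \<le> n"
  shows "(1 - XX n * YY n) * CP20 n
    = (mfps_Sum (weight n) (cylindric20_le n (n - 1)) :: (var, 'a::comm_ring_1) mfps)"
proof -
  have "{(a, b) \<in> cylindric20_le n n. a n = 0 \<or> n > 0 \<and> b n = 0} = cylindric20_le n (n - 1)"
  proof (intro equalityI subsetI; clarify)
    fix a b assume "(a, b) \<in> cylindric20_le n n" "a n = 0 \<or> n > 0 \<and> b n = 0"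
    then have c: "(a, b) \<in> cylindric20 n" and "b n = 0"
      using assms by (auto simp: cylindric20_le_def cylindric20_def)
    then have "b j = 0" if "j > n - 1" for j
      using that by (cases "j = n") (auto simp: cylindric20_def)
    with c show "(a, b) \<in> cylindric20_le n (n - 1)"
      by (simp add: cylindric20_le_def)
  next
    fix a b assume "(a, b) \<in> cylindric20_le n (n - 1)"
    then show "(a, b) \<in> cylindric20_le n n \<and> (a n = 0 \<or> n > 0 \<and> b n = 0)"
      using assms by (auto simp: cylindric20_le_def)
  qed
  then show ?thesis
    using peel_cylindric20_le[of n n] assms by (simp add: cylindric20_le_self CP20_def)
qed

theorem theorem3p3:
  fixes n :: nat
  assumes "n > 1"
  shows "(CP20 n :: (var, 'a::comm_ring_1) mfps) =
    (1 - XX (n - 1) * XX n * YY (n - 2) * YY (n - 1)) /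
    ((1 - XX n * YY (n - 2)) * (1 - XX n * YY (n - 1)) * (1 - XX n * YY n)) * CP20 (n - 1)"
proof -
  let ?S = "mfps_Sum (weight n) :: _ \<Rightarrow> (var, 'a) mfps"
  let ?P = "cylindric20 (n - 1)" and ?R = "cylindric20_le n (n - 2)"
  define u v w r :: "(var, 'a) mfps"
    where "u = XX n * YY (n - 2)" and "v = XX n * YY (n - 1)" and "w = XX n * YY n"
      and "r = XX (n - 1) * YY (n - 1)"
  \<comment> \<open>For \<open>k < n\<close> the truncated subtraction is exact, so lowering the
    bound by one adds exactly one vanishing entry.\<close>
  have le_iff: "(a, b) \<in> cylindric20_le n (n - Suc k) \<longleftrightarrow>
      (a, b) \<in> cylindric20_le n (n - k) \<and> b (n - k) = 0" if "k < n" for a b k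
  proof -
    have "j > n - Suc k \<longleftrightarrow> j > n - k \<or> j = n - k" for j
      using that by auto
    then show ?thesis
      by (auto simp: cylindric20_le_def)
  qed
  have n1: "(a, b) \<in> cylindric20_le n (n - 1) \<longleftrightarrow> (a, b) \<in> cylindric20 n \<and> b n = 0" for a b
    using le_iff[of 0] assms by (simp add: cylindric20_le_self)
  have n2: "(a, b) \<in> ?R \<longleftrightarrow> (a, b) \<in> cylindric20 n \<and> b n = 0 \<and> b (n - 1) = 0" for a b
    using le_iff[of 1] n1 assms by (simp add: numeral_2_eq_2)
  have P: "(a, b) \<in> ?P \<longleftrightarrow> (a, b) \<in> cylindric20 n \<and> a n = 0 \<and> b n = 0" for a b
    using cylindric20_pred[OF assms] by auto

  have "(1 - v) * ?S (cylindric20_le n (n - 1))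
      = ?S {(a, b) \<in> cylindric20_le n (n - 1). a n = 0 \<or> n - 1 > 0 \<and> b (n - 1) = 0}"
    unfolding v_def using assms by (intro peel_cylindric20_le) auto
  also have "{(a, b) \<in> cylindric20_le n (n - 1). a n = 0 \<or> n - 1 > 0 \<and> b (n - 1) = 0} = ?P \<union> ?R"
    using n1 n2 P assms by auto
  finally have step: "(1 - v) * ((1 - w) * CP20 n) = ?S (?P \<union> ?R)"
    using peel_CP20[where 'a = 'a, of n] assms by (simp add: w_def)

  have "mfps_summable (weight n :: _ \<Rightarrow> (var, 'a) mfps) ?P"
    by (rule mfps_summable_subset[OF mfps_summable_CP20]) (use P in auto)
  then have incl_excl: "?S (?P \<union> ?R) + ?S (?P \<inter> ?R) = CP20 (n - 1) + ?S ?R"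
    unfolding CP20_pred[OF assms] by (rule mfps_Sum_Un_Int[OF _ mfps_summable_weight_cylindric20_le])

  have "(1 - u) * ?S ?R = ?S {(a, b) \<in> ?R. a n = 0 \<or> n - 2 > 0 \<and> b (n - 2) = 0}"
    unfolding u_def using assms by (intro peel_cylindric20_le) auto
  also have "{(a, b) \<in> ?R. a n = 0 \<or> n - 2 > 0 \<and> b (n - 2) = 0} = ?P \<inter> ?R"
  proof -
    \<comment> \<open>Thus \<open>b (n - 2) = 0\<close> forces \<open>a n = 0\<close> and the
      disjunction collapses; for \<open>n = 2\<close> the guard has already removed that
      alternative.\<close>
    have "a n \<le> b (n - 2)" if "(a, b) \<in> cylindric20 n" "n - 2 > 0" for a b
    proof -
      have "a (n - 2 + 2) \<le> b (n - 2)"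
        using that by (auto simp: cylindric20_def simp del: One_nat_def)
      also have "n - 2 + 2 = n"
        using assms by simp
      finally show ?thesis .
    qed
    then show ?thesis
      using n2 P by fastforce
  qed
  finally have R: "(1 - u) * ?S ?R = ?S (?P \<inter> ?R)" .

  have "(1 - r) * CP20 (n - 1)
      = mfps_Sum (weight (n - 1)) (cylindric20_le (n - 1) (n - 1 - 1))"
    using assms peel_CP20[where 'a = 'a, of "n - 1"] by (simp add: r_def)
  also have "\<dots> = ?S (?P \<inter> ?R)"
  proof (rule mfps_Sum_cong)
    have "(a, b) \<in> cylindric20_le (n - 1) (n - 1 - 1) \<longleftrightarrow> (a, b) \<in> ?P \<and> (a, b) \<in> ?R" for a b
      using P by (auto simp: cylindric20_le_def numeral_2_eq_2)
    then show "cylindric20_le (n - 1) (n - 1 - 1) = ?P \<inter> ?R"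
      by auto
  qed (use weight_pred[OF assms] in blast)
  finally have PR: "?S (?P \<inter> ?R) = (1 - r) * CP20 (n - 1)" by simp

  have "(1 - u) * (1 - v) * (1 - w) * CP20 n = (1 - u) * ?S (?P \<union> ?R)"
    by (simp add: mult.assoc step)
  also have "?S (?P \<union> ?R) = CP20 (n - 1) + ?S ?R - ?S (?P \<inter> ?R)"
    using incl_excl by (simp add: eq_diff_eq)
  also have "(1 - u) * \<dots> = (1 - u) * CP20 (n - 1) + (1 - r) * CP20 (n - 1)
      - (1 - u) * ((1 - r) * CP20 (n - 1))"
    by (simp only: distrib_left right_diff_distrib R PR)
  \<comment> \<open>The numerator arises from
    \<open>(1 - u) + (1 - r) - (1 - u) * (1 - r) = 1 - r * u\<close>.\<close>
  also have "\<dots> = (1 - r * u) * CP20 (n - 1)"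
    by (simp add: algebra_simps)
  also have "r * u = XX (n - 1) * XX n * YY (n - 2) * YY (n - 1)"
    by (simp add: r_def u_def mult_ac)
  finally have "(1 - u) * (1 - v) * (1 - w) * CP20 n
      = (1 - XX (n - 1) * XX n * YY (n - 2) * YY (n - 1)) * CP20 (n - 1)" .
  moreover have "(1 - u) * (1 - v) * (1 - w) dvd 1"
  proof -
    have "(1 - u) * (1 - v) * (1 - w) dvd 1 * 1 * 1"
      unfolding u_def v_def w_def using assms
      by (intro mult_dvd_mono dvd_one_minus_XX_mult_YY) auto
    then show ?thesis by simp
  qed
  ultimately show ?thesis
    unfolding u_def v_def w_def by (intro mfps_eq_divide_multI)
qed

end
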